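(* Let $X$ be a Banach space and let $Y$ be a closed linear subspace of $X$. Suppose the pair $(B_Y,\mathcal{CB}(X))$ has the restricted center property. Then: (i) For each $\lambda>0$ and $B\in\mathcal{CB}(X)$, $\mathrm{cent}_{\lambda B_Y}(\cdot)$ is lower Hausdorff semi-continuous (resp. upper Hausdorff semi-continuous) at $B$ if and only if $\mathrm{cent}_{B_Y}(\cdot)$ is lower Hausdorff semi-continuous (resp. upper Hausdorff semi-continuous) at $\frac1\lambda B$. (ii) If $\mathrm{cent}_{B_Y}(\cdot)$ is lower Hausdorff semi-continuous (resp. upper Hausdorff semi-continuous) on $\mathcal{CB}(X)$, then $\mathrm{cent}_Y(\cdot)$ is lower Hausdorff semi-continuous (resp. upper Hausdorff semi-continuous) on $\mathcal{CB}(X)$. (iii) For each $\lambda>0$ and $B\in\mathcal{CB}(X)$, $\mathrm{cent}_{\lambda B_Y}(\cdot)$ is Hausdorff metric continuous at $B$ if and only if $\mathrm{cent}_{B_Y}(\cdot)$ is Hausdorff metric continuous at $\frac1\lambda B$. (iv) If $\mathrm{cent}_{B_Y}(\cdot)$ is Hausdorff metric continuous on $\mathcal{CB}(X)$, then $\mathrm{cent}_Y(\cdot)$ is Hausdorff metric continuous on $\mathcal{CB}(X)$.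
   Context: All Banach spaces are real. $B_X$ is the closed unit ball of $X$, $B_Y=B_X\cap Y$, $B_X(z,\varepsilon)$ is the open ball of center $z$ and radius $\varepsilon$, and $\lambda A=\{\lambda a:a\in A\}$. $\mathcal{CB}(X)$ is the class of non-empty closed bounded subsets of $X$, equipped with the Hausdorff metric $d_H(A,B)=\inf\{t>0: A\subseteq B+tB_X,\ B\subseteq A+tB_X\}$. For $v\in X$ and a non-empty bounded set $F\subseteq X$, $r(v,F)=\sup_{z\in F}\|v-z\|$. For a non-empty closed convex $V\subseteq X$: $\mathrm{rad}_V(F)=\inf_{v\in V}r(v,F)$ and $\mathrm{cent}_V(F)=\{v\in V: r(v,F)=\mathrm{rad}_V(F)\}$. The pair $(V,\mathcal{CB}(X))$ has the restricted center property if $\mathrm{cent}_V(F)\ne\emptyset$ for every $F\in\mathcal{CB}(X)$. A set-valued map $\Phi:\mathcal{CB}(X)\to\mathcal{CB}(X)$ is: lower Hausdorff semi-continuous at $B$ if for each $\varepsilon>0$ there is $\delta>0$ such that for every $A\in\mathcal{CB}(X)$ with $d_H(A,B)<\delta$ and every $z\in\Phi(B)$, $B_X(z,\varepsilon)\cap\Phi(A)\ne\emptyset$; upper Hausdorff semi-continuous at $B$ if for each $\varepsilon>0$ there is $\delta>0$ such that $\Phi(A)\subseteq\Phi(B)+\varepsilon B_X$ for every $A\in\mathcal{CB}(X)$ with $d_H(A,B)<\delta$; Hausdorff metric continuous at $B$ if it is continuous at $B$ as a single-valued map from $(\mathcal{CB}(X),d_H)$ to $(\mathcal{CB}(X),d_H)$.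 Each property holds "on $\mathcal{CB}(X)$" if it holds at every $B\in\mathcal{CB}(X)$. *)

theory Defs
  imports "HOL-Analysis.Analysis" "HOL-Library.Set_Algebras"
begin

text \<open>The Banach space \<open>X\<close> is the whole type \<open>'a\<close>, and sums of sets are Minkowski sums.\<close>

definition scale_set :: "real \<Rightarrow> 'a::real_vector set \<Rightarrow> 'a set" where
  "scale_set c A = (\<lambda>a. c *\<^sub>R a) ` A"

definition unit_ball_of :: "'a::real_normed_vector set \<Rightarrow> 'a set" where
  "unit_ball_of Y = cball 0 1 \<inter> Y"

definition CB :: "'a::real_normed_vector set set" where
  "CB = {A. A \<noteq> {} \<and> closed A \<and> bounded A}"

text \<open>As an infimum of reals, this is meaningful for non-empty bounded \<open>A\<close>, \<open>B\<close> only.\<close>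

definition hausdorff_dist :: "'a::real_normed_vector set \<Rightarrow> 'a set \<Rightarrow> real" where
  "hausdorff_dist A B =
     Inf {t. t > 0 \<and> A \<subseteq> B + scale_set t (cball 0 1) \<and> B \<subseteq> A + scale_set t (cball 0 1)}"

definition radius_at :: "'a::real_normed_vector \<Rightarrow> 'a set \<Rightarrow> real" where
  "radius_at v F = (SUP z\<in>F. norm (v - z))"

definition rad :: "'a::real_normed_vector set \<Rightarrow> 'a set \<Rightarrow> real" where
  "rad V F = (INF v\<in>V. radius_at v F)"

definition cent :: "'a::real_normed_vector set \<Rightarrow> 'a set \<Rightarrow> 'a set" where
  "cent V F = {v \<in> V. radius_at v F = rad V F}"

definition restricted_center_property :: "'a::real_normed_vector set \<Rightarrow> bool" where
  "restricted_center_property V \<longleftrightarrow> (\<forall>F\<in>CB. cent V F \<noteq> {})"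

text \<open>The continuity notions below are defined for maps from \<open>CB\<close> to \<open>CB\<close>. Since \<open>\<Phi>\<close> is a
  total function on all sets, the clause \<open>\<Phi> \<in> CB \<rightarrow> CB\<close> states this explicitly; in particular
  the values of \<open>\<Phi>\<close> on \<open>CB\<close> are non-empty, so that \<open>hausdorff_dist\<close> is meaningful on them.\<close>

definition lower_Hausdorff_semicont_at ::
    "('a::real_normed_vector set \<Rightarrow> 'a set) \<Rightarrow> 'a set \<Rightarrow> bool" where
  "lower_Hausdorff_semicont_at \<Phi> B \<longleftrightarrow> \<Phi> \<in> CB \<rightarrow> CB \<and>
     (\<forall>\<epsilon>>0. \<exists>\<delta>>0. \<forall>A\<in>CB. hausdorff_dist A B < \<delta> \<longrightarrow> (\<forall>z\<in>\<Phi> B. ball z \<epsilon> \<inter> \<Phi> A \<noteq> {}))"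

definition upper_Hausdorff_semicont_at ::
    "('a::real_normed_vector set \<Rightarrow> 'a set) \<Rightarrow> 'a set \<Rightarrow> bool" where
  "upper_Hausdorff_semicont_at \<Phi> B \<longleftrightarrow> \<Phi> \<in> CB \<rightarrow> CB \<and>
     (\<forall>\<epsilon>>0. \<exists>\<delta>>0. \<forall>A\<in>CB. hausdorff_dist A B < \<delta> \<longrightarrow> \<Phi> A \<subseteq> \<Phi> B + scale_set \<epsilon> (cball 0 1))"

definition Hausdorff_metric_cont_at ::
    "('a::real_normed_vector set \<Rightarrow> 'a set) \<Rightarrow> 'a set \<Rightarrow> bool" where
  "Hausdorff_metric_cont_at \<Phi> B \<longleftrightarrow> \<Phi> \<in> CB \<rightarrow> CB \<and>
     (\<forall>\<epsilon>>0. \<exists>\<delta>>0. \<forall>A\<in>CB. hausdorff_dist A B < \<delta> \<longrightarrow> hausdorff_dist (\<Phi> A) (\<Phi> B) < \<epsilon>)"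

end

theory Submission
  imports Defs
begin

text \<open>Scaling \<open>X\<close> by \<open>l > 0\<close> maps \<open>cent V (F / l)\<close> onto \<open>cent (l V) F\<close> and multiplies Hausdorff
  distances by \<open>l\<close>, which gives (i) and (iii). For (ii) and (iv): if all points of \<open>F\<close> have norm
  at most \<open>M\<close>, then a point \<open>v\<close> with \<open>norm v > 2 M\<close> is farther from some point of \<open>F\<close> than the
  origin is from any, so \<open>cent Y F\<close> is already the set of centers in a large ball of \<open>Y\<close>, and the
  radius of this ball can be chosen uniformly for all \<open>F\<close> near a given \<open>B\<close>.\<close>

section \<open>Scaling and the Hausdorff distance\<close>

lemma scale_set_scale_set: "scale_set a (scale_set b A) = scale_set (a * b) A"
  by (simp add: scale_set_def image_image)

lemma scale_set_one [simp]: "scale_set 1 A = A"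
  by (simp add: scale_set_def)

lemma scale_set_CB: "A \<in> CB \<Longrightarrow> scale_set c A \<in> CB"
  by (auto simp: CB_def scale_set_def intro: closed_scaling bounded_scaling)

text \<open>Trades Minkowski sums for pointwise norm estimates; \<open>t > 0\<close> permits
  rescaling a difference \<open>a - b\<close> into the unit ball.\<close>

lemma subset_plus_scale_cball_iff:
  fixes A B :: "'a::real_normed_vector set"
  assumes "t > 0"
  shows "A \<subseteq> B + scale_set t (cball 0 1) \<longleftrightarrow> (\<forall>a\<in>A. \<exists>b\<in>B. norm (a - b) \<le> t)"
proof -
  have "a \<in> B + scale_set t (cball 0 1) \<longleftrightarrow> (\<exists>b\<in>B. norm (a - b) \<le> t)" for a
  proof
    assume "a \<in> B + scale_set t (cball 0 1)"
    then show "\<exists>b\<in>B. norm (a - b) \<le> t"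
      using assms by (force simp: scale_set_def set_plus_def)
  next
    assume "\<exists>b\<in>B. norm (a - b) \<le> t"
    then obtain b where b: "b \<in> B" "norm (a - b) \<le> t" by blast
    have "a = b + t *\<^sub>R ((1 / t) *\<^sub>R (a - b))" and "(1 / t) *\<^sub>R (a - b) \<in> cball 0 1"
      using b assms by auto
    then show "a \<in> B + scale_set t (cball 0 1)"
      using b(1) unfolding scale_set_def by (metis imageI set_plus_intro)
  qed
  then show ?thesis by blast
qed

lemma scale_set_subset_plus_scale_cball:
  fixes A B :: "'a::real_normed_vector set"
  assumes "c > 0" "t > 0" "A \<subseteq> B + scale_set t (cball 0 1)"
  shows "scale_set c A \<subseteq> scale_set c B + scale_set (c * t) (cball 0 1)"
proof -
  have "\<exists>b\<in>B. norm (c *\<^sub>R a - c *\<^sub>R b) \<le> c * t" if "a \<in> A" for a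
    using assms that
    by (auto simp: subset_plus_scale_cball_iff simp flip: scaleR_diff_right)
  then show ?thesis
    unfolding subset_plus_scale_cball_iff[OF mult_pos_pos[OF assms(1,2)]]
    by (auto simp: scale_set_def)
qed

text \<open>An infimum lies below \<open>d\<close> exactly when some admissible \<open>t\<close>
  does, attained or not. Membership in \<open>CB\<close> makes the infimum meaningful: if
  \<open>M\<close> bounds all norms in \<open>A\<close> and \<open>B\<close>, then
  \<open>2 * M\<close> is admissible by the triangle inequality.\<close>

lemma hausdorff_dist_less_iff:
  assumes "A \<in> CB" "B \<in> CB"
  shows "hausdorff_dist A B < d \<longleftrightarrow>
    (\<exists>t. t > 0 \<and> t < d \<and> A \<subseteq> B + scale_set t (cball 0 1) \<and> B \<subseteq> A + scale_set t (cball 0 1))"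
proof -
  let ?S = "{t. t > 0 \<and> A \<subseteq> B + scale_set t (cball 0 1) \<and> B \<subseteq> A + scale_set t (cball 0 1)}"
  obtain M where M: "\<And>x. x \<in> A \<union> B \<Longrightarrow> norm x \<le> M" "M > 0"
    using assms bounded_pos[of "A \<union> B"] by (auto simp: CB_def)
  have close: "norm (a - b) \<le> 2 * M" if "a \<in> A \<union> B" "b \<in> A \<union> B" for a b
    using norm_triangle_ineq4[of a b] M(1)[OF that(1)] M(1)[OF that(2)] by linarith
  obtain a b where ab: "a \<in> A" "b \<in> B" using assms by (auto simp: CB_def)
  have "2 * M \<in> ?S"
    using M(2) ab close by (auto simp: subset_plus_scale_cball_iff)
  then have "?S \<noteq> {}" by blast
  moreover have "bdd_below ?S" by (rule bdd_belowI[of _ 0]) simp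
  ultimately show ?thesis
    unfolding hausdorff_dist_def by (subst cInf_less_iff) auto
qed

lemma hausdorff_dist_scale_set_less:
  assumes "A \<in> CB" "B \<in> CB" "c > 0" "hausdorff_dist A B < d"
  shows "hausdorff_dist (scale_set c A) (scale_set c B) < c * d"
proof -
  obtain t where "t > 0" "t < d"
    "A \<subseteq> B + scale_set t (cball 0 1)" "B \<subseteq> A + scale_set t (cball 0 1)"
    using assms by (auto simp: hausdorff_dist_less_iff)
  then have "c * t > 0 \<and> c * t < c * d \<and>
      scale_set c A \<subseteq> scale_set c B + scale_set (c * t) (cball 0 1) \<and>
      scale_set c B \<subseteq> scale_set c A + scale_set (c * t) (cball 0 1)"
    using assms(3) by (simp add: scale_set_subset_plus_scale_cball)
  then show ?thesis
    unfolding hausdorff_dist_less_iff[OF scale_set_CB[OF assms(1)] scale_set_CB[OF assms(2)]]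
    by blast
qed

section \<open>Radii and centers under scaling and restriction to a ball\<close>

lemma radius_at_le_iff:
  assumes "F \<in> CB"
  shows "radius_at v F \<le> r \<longleftrightarrow> (\<forall>z\<in>F. norm (v - z) \<le> r)"
proof -
  obtain M where M: "\<And>z. z \<in> F \<Longrightarrow> norm z \<le> M"
    using assms bounded_pos[of F] by (auto simp: CB_def)
  have "bdd_above ((\<lambda>z. norm (v - z)) ` F)"
    using M by (auto intro!: bdd_aboveI[of _ "norm v + M"] norm_triangle_le_diff)
  moreover have "F \<noteq> {}" using assms by (simp add: CB_def)
  ultimately show ?thesis
    unfolding radius_at_def by (rule cSUP_le_iff[rotated])
qed

lemma norm_diff_le_radius_at: "F \<in> CB \<Longrightarrow> z \<in> F \<Longrightarrow> norm (v - z) \<le> radius_at v F"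
  using radius_at_le_iff by blast

lemma radius_at_nonneg: "F \<in> CB \<Longrightarrow> 0 \<le> radius_at v F"
proof -
  assume F: "F \<in> CB"
  then obtain z where "z \<in> F" by (auto simp: CB_def)
  then show ?thesis using norm_diff_le_radius_at[OF F] norm_ge_zero order_trans by blast
qed

text \<open>Describes centers as minimizers of the radius, so that \<open>rad\<close> disappears
  from all later arguments. Radii are bounded below by 0, hence the infimum over a set containing
  \<open>v\<close> is a genuine one.\<close>

lemma cent_iff:
  assumes "F \<in> CB"
  shows "v \<in> cent V F \<longleftrightarrow> v \<in> V \<and> (\<forall>w\<in>V. radius_at v F \<le> radius_at w F)"
proof (cases "v \<in> V")
  case True
  have "bdd_below ((\<lambda>w. radius_at w F) ` V)"
    using radius_at_nonneg[OF assms] by (auto intro: bdd_belowI[of _ 0])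
  then have "r \<le> rad V F \<longleftrightarrow> (\<forall>w\<in>V. r \<le> radius_at w F)" for r
    unfolding rad_def using True by (intro le_cINF_iff) auto
  moreover from this have "rad V F \<le> radius_at v F" using True by blast
  ultimately show ?thesis using True by (force simp: cent_def)
qed (simp add: cent_def)

lemma radius_at_scale_set:
  assumes "F \<in> CB" "c > 0"
  shows "radius_at (c *\<^sub>R v) (scale_set c F) = c * radius_at v F"
proof -
  \<comment> \<open>Equality of the two radii follows once they have the same upper bounds
    \<open>r\<close>.\<close>
  have "radius_at (c *\<^sub>R v) (scale_set c F) \<le> r \<longleftrightarrow> c * radius_at v F \<le> r" for r
  proof -
    have "radius_at (c *\<^sub>R v) (scale_set c F) \<le> r \<longleftrightarrow> (\<forall>z\<in>F. norm (c *\<^sub>R v - c *\<^sub>R z) \<le> r)"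
      using radius_at_le_iff[OF scale_set_CB[OF assms(1)]] by (simp add: scale_set_def)
    also have "\<dots> \<longleftrightarrow> (\<forall>z\<in>F. norm (v - z) \<le> r / c)"
      using assms(2) by (simp add: pos_le_divide_eq mult.commute flip: scaleR_diff_right)
    also have "\<dots> \<longleftrightarrow> c * radius_at v F \<le> r"
      unfolding radius_at_le_iff[OF assms(1), symmetric]
      using assms(2) by (simp add: pos_le_divide_eq mult.commute)
    finally show ?thesis .
  qed
  then show ?thesis using order_antisym by blast
qed

text \<open>Multiplication by \<open>c\<close> maps \<open>V\<close> onto its dilate and multiplies
  every radius by the same positive factor, so minimizers correspond to minimizers.\<close>

lemma cent_scale_set:
  assumes "F \<in> CB" "c > 0"
  shows "cent (scale_set c V) (scale_set c F) = scale_set c (cent V F)"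
proof -
  have iff: "c *\<^sub>R v \<in> cent (scale_set c V) (scale_set c F) \<longleftrightarrow> v \<in> cent V F" for v
    unfolding cent_iff[OF assms(1)] cent_iff[OF scale_set_CB[OF assms(1)]]
      radius_at_scale_set[OF assms]
    using assms by (auto simp: scale_set_def radius_at_scale_set[unfolded scale_set_def])
  show ?thesis
  proof (intro equalityI subsetI)
    fix x assume x: "x \<in> cent (scale_set c V) (scale_set c F)"
    then obtain v where "x = c *\<^sub>R v" by (auto simp: cent_def scale_set_def)
    then show "x \<in> scale_set c (cent V F)" using x iff unfolding scale_set_def by blast
  next
    fix x assume "x \<in> scale_set c (cent V F)"
    then obtain v where "v \<in> cent V F" "x = c *\<^sub>R v" unfolding scale_set_def by blast
    then show "x \<in> cent (scale_set c V) (scale_set c F)" using iff by simp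
  qed
qed

lemma cent_scale_set_ball_eq:
  assumes Y: "subspace Y" and F: "F \<in> CB" and l: "l > 0"
    and M: "\<And>z. z \<in> F \<Longrightarrow> norm z \<le> M" "2 * M < l"
  shows "cent (scale_set l (unit_ball_of Y)) F = cent Y F"
proof -
  have ball: "scale_set l (unit_ball_of Y) = {v \<in> Y. norm v \<le> l}"
  proof (intro equalityI subsetI)
    fix v assume "v \<in> scale_set l (unit_ball_of Y)"
    then show "v \<in> {v \<in> Y. norm v \<le> l}"
      using l Y by (auto simp: scale_set_def unit_ball_of_def subspace_scale)
  next
    fix v assume "v \<in> {v \<in> Y. norm v \<le> l}"
    then have "v = l *\<^sub>R ((1 / l) *\<^sub>R v)" "(1 / l) *\<^sub>R v \<in> unit_ball_of Y"
      using l Y by (auto simp: unit_ball_of_def subspace_scale)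
    then show "v \<in> scale_set l (unit_ball_of Y)"
      unfolding scale_set_def by (metis imageI)
  qed
  obtain z where z: "z \<in> F" using F by (auto simp: CB_def)
  have zero: "0 \<in> Y" using Y by (rule subspace_0)
  \<comment> \<open>Seen from the origin, \<open>F\<close> lies within \<open>M\<close>, whereas a
    point of norm above \<open>l\<close> is at distance more than \<open>l - M > M\<close> from
    \<open>z\<close>.\<close>
  have far: "radius_at 0 F < radius_at v F" if "norm v > l" for v
  proof -
    have "radius_at 0 F \<le> M" using F M(1) by (simp add: radius_at_le_iff)
    moreover have "norm v - norm z \<le> radius_at v F"
      using norm_diff_le_radius_at[OF F z] norm_triangle_ineq2 order_trans by blast
    ultimately show ?thesis using M(1)[OF z] M(2) that by linarith
  qed
  show ?thesis
  proof (intro equalityI subsetI)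
    fix v assume "v \<in> cent (scale_set l (unit_ball_of Y)) F"
    then have v: "v \<in> Y" "\<And>w. w \<in> Y \<Longrightarrow> norm w \<le> l \<Longrightarrow> radius_at v F \<le> radius_at w F"
      by (auto simp: cent_iff[OF F] ball)
    \<comment> \<open>Inside the ball this is the minimality of \<open>v\<close>; outside it, the
      origin serves as an intermediate competitor.\<close>
    have "radius_at v F \<le> radius_at w F" if "w \<in> Y" for w
      using v(2)[OF that] v(2)[OF zero] l far[of w] by fastforce
    then show "v \<in> cent Y F" using v(1) by (simp add: cent_iff[OF F])
  next
    fix v assume "v \<in> cent Y F"
    \<comment> \<open>A center in \<open>Y\<close> of norm above \<open>l\<close> would be strictly
      beaten by the origin.\<close>
    then show "v \<in> cent (scale_set l (unit_ball_of Y)) F"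
      using far[of v] zero by (force simp: cent_iff[OF F] ball)
  qed
qed

text \<open>The three continuity notions are instances of one scheme, in which \<open>Q\<close> compares the
  values of \<open>\<Phi>\<close>.\<close>

definition cont_wrt ::
    "(real \<Rightarrow> 'a::real_normed_vector set \<Rightarrow> 'a set \<Rightarrow> bool) \<Rightarrow> ('a set \<Rightarrow> 'a set) \<Rightarrow> 'a set \<Rightarrow> bool" where
  "cont_wrt Q \<Phi> B \<longleftrightarrow> \<Phi> \<in> CB \<rightarrow> CB \<and>
     (\<forall>\<epsilon>>0. \<exists>\<delta>>0. \<forall>A\<in>CB. hausdorff_dist A B < \<delta> \<longrightarrow> Q \<epsilon> (\<Phi> A) (\<Phi> B))"

text \<open>Captures what the transfer arguments require of \<open>Q\<close>, so that each is
  carried out once for all three notions. The sets range over \<open>CB\<close>, where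
  \<open>hausdorff_dist\<close> is meaningful.\<close>

definition homogeneous :: "(real \<Rightarrow> 'a::real_normed_vector set \<Rightarrow> 'a set \<Rightarrow> bool) \<Rightarrow> bool" where
  "homogeneous Q \<longleftrightarrow> (\<forall>c>0. \<forall>\<epsilon>>0. \<forall>A\<in>CB. \<forall>B\<in>CB.
     Q \<epsilon> A B \<longrightarrow> Q (c * \<epsilon>) (scale_set c A) (scale_set c B))"

lemma lower_Hausdorff_semicont_at_eq:
  "lower_Hausdorff_semicont_at = cont_wrt (\<lambda>\<epsilon> A B. \<forall>z\<in>B. ball z \<epsilon> \<inter> A \<noteq> {})"
  by (intro ext) (simp add: lower_Hausdorff_semicont_at_def cont_wrt_def)

lemma upper_Hausdorff_semicont_at_eq:
  "upper_Hausdorff_semicont_at = cont_wrt (\<lambda>\<epsilon> A B. A \<subseteq> B + scale_set \<epsilon> (cball 0 1))"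
  by (intro ext) (simp add: upper_Hausdorff_semicont_at_def cont_wrt_def)

lemma Hausdorff_metric_cont_at_eq:
  "Hausdorff_metric_cont_at = cont_wrt (\<lambda>\<epsilon> A B. hausdorff_dist A B < \<epsilon>)"
  by (intro ext) (simp add: Hausdorff_metric_cont_at_def cont_wrt_def)

lemma homogeneous_lower: "homogeneous (\<lambda>\<epsilon> A B. \<forall>z\<in>B. ball z \<epsilon> \<inter> A \<noteq> {})"
  unfolding homogeneous_def
proof (intro allI impI ballI)
  fix c \<epsilon> :: real and A B :: "'a set" and z
  assume c: "c > 0" and Q: "\<forall>z\<in>B. ball z \<epsilon> \<inter> A \<noteq> {}" and "z \<in> scale_set c B"
  then obtain b where b: "b \<in> B" "z = c *\<^sub>R b" by (auto simp: scale_set_def)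
  then obtain a where "a \<in> A" "dist b a < \<epsilon>" using Q by fastforce
  then have "c *\<^sub>R a \<in> ball z (c * \<epsilon>) \<inter> scale_set c A"
    using b(2) c by (auto simp: dist_norm scale_set_def simp flip: scaleR_diff_right)
  then show "ball z (c * \<epsilon>) \<inter> scale_set c A \<noteq> {}" by blast
qed

lemma homogeneous_upper: "homogeneous (\<lambda>\<epsilon> A B. A \<subseteq> B + scale_set \<epsilon> (cball 0 1))"
  unfolding homogeneous_def using scale_set_subset_plus_scale_cball by blast

lemma homogeneous_hausdorff_dist: "homogeneous (\<lambda>\<epsilon> A B. hausdorff_dist A B < \<epsilon>)"
  unfolding homogeneous_def using hausdorff_dist_scale_set_less by blast

section \<open>Transfer of continuity between balls of \<open>Y\<close> and to \<open>Y\<close>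
  itself\<close>

lemma cont_wrt_scale:
  assumes Q: "homogeneous Q" and c: "c > 0" and B: "B \<in> CB"
    and cont: "cont_wrt Q \<Phi> (scale_set (1 / c) B)"
    and eq: "\<And>A. A \<in> CB \<Longrightarrow> \<Psi> A = scale_set c (\<Phi> (scale_set (1 / c) A))"
  shows "cont_wrt Q \<Psi> B"
  unfolding cont_wrt_def
proof (intro conjI allI impI)
  have CB: "\<Phi> \<in> CB \<rightarrow> CB" using cont by (simp add: cont_wrt_def)
  then show "\<Psi> \<in> CB \<rightarrow> CB" by (auto simp: eq intro!: scale_set_CB)
  fix \<epsilon> :: real assume "\<epsilon> > 0"
  then have "\<epsilon> / c > 0" using c by simp
  then obtain \<delta> where \<delta>: "\<delta> > 0" "\<And>A. A \<in> CB \<Longrightarrow>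
      hausdorff_dist A (scale_set (1 / c) B) < \<delta> \<Longrightarrow> Q (\<epsilon> / c) (\<Phi> A) (\<Phi> (scale_set (1 / c) B))"
    using cont unfolding cont_wrt_def by blast
  \<comment> \<open>Passing to \<open>scale_set (1 / c) A\<close> divides distances by
    \<open>c\<close>, which turns \<open>c * \<delta>\<close> into \<open>\<delta>\<close>; scaling
    the values back by \<open>c\<close> turns the tolerance \<open>\<epsilon> / c\<close> into
    \<open>\<epsilon>\<close>.\<close>
  have "Q \<epsilon> (\<Psi> A) (\<Psi> B)" if A: "A \<in> CB" and "hausdorff_dist A B < c * \<delta>" for A
  proof -
    have "hausdorff_dist (scale_set (1 / c) A) (scale_set (1 / c) B) < \<delta>"
      using hausdorff_dist_scale_set_less[OF A B, of "1 / c" "c * \<delta>"] that c by simp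
    then have "Q (\<epsilon> / c) (\<Phi> (scale_set (1 / c) A)) (\<Phi> (scale_set (1 / c) B))"
      by (intro \<delta>(2) scale_set_CB A)
    moreover have "\<Phi> (scale_set (1 / c) A) \<in> CB" "\<Phi> (scale_set (1 / c) B) \<in> CB"
      using CB scale_set_CB A B by blast+
    ultimately have "Q (c * (\<epsilon> / c)) (\<Psi> A) (\<Psi> B)"
      using Q c \<open>\<epsilon> / c > 0\<close> unfolding homogeneous_def eq[OF A] eq[OF B] by blast
    then show ?thesis using c by simp
  qed
  then show "\<exists>\<delta>>0. \<forall>A\<in>CB. hausdorff_dist A B < \<delta> \<longrightarrow> Q \<epsilon> (\<Psi> A) (\<Psi> B)"
    using \<open>\<delta> > 0\<close> c by (intro exI[of _ "c * \<delta>"]) simp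
qed

lemma cont_wrt_cent_scale_iff:
  assumes Q: "homogeneous Q" and l: "l > 0" and B: "B \<in> CB"
  shows "cont_wrt Q (cent (scale_set l V)) B \<longleftrightarrow> cont_wrt Q (cent V) (scale_set (1 / l) B)"
proof
  assume "cont_wrt Q (cent (scale_set l V)) B"
  \<comment> \<open>The forward direction is the same transfer with factor \<open>1 / l\<close>, so
    \<open>B\<close> is rewritten as the dilate by \<open>1 / (1 / l)\<close> of its own
    contraction.\<close>
  then have cont: "cont_wrt Q (cent (scale_set l V)) (scale_set (1 / (1 / l)) (scale_set (1 / l) B))"
    using l by (simp add: scale_set_scale_set)
  have "cent V A = scale_set (1 / l) (cent (scale_set l V) (scale_set (1 / (1 / l)) A))"
    if "A \<in> CB" for A
    using that l by (simp add: cent_scale_set scale_set_scale_set)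
  then show "cont_wrt Q (cent V) (scale_set (1 / l) B)"
    using l cont_wrt_scale[OF Q _ scale_set_CB[OF B] cont] by simp
next
  assume cont: "cont_wrt Q (cent V) (scale_set (1 / l) B)"
  have "cent (scale_set l V) A = scale_set l (cent V (scale_set (1 / l) A))"
    if "A \<in> CB" for A
    using cent_scale_set[OF scale_set_CB[OF that], of l V "1 / l"] l
    by (simp add: scale_set_scale_set)
  then show "cont_wrt Q (cent (scale_set l V)) B"
    by (rule cont_wrt_scale[OF Q l B cont])
qed

lemma cont_wrt_cent_subspace:
  assumes Q: "homogeneous Q" and Y: "subspace Y" and B: "B \<in> CB"
    and cont: "\<And>B. B \<in> CB \<Longrightarrow> cont_wrt Q (cent (unit_ball_of Y)) B"
  shows "cont_wrt Q (cent Y) B"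
proof -
  have cont': "cont_wrt Q (cent (scale_set l (unit_ball_of Y))) B" if "l > 0" for l
    using cont_wrt_cent_scale_iff[OF Q that B] cont scale_set_CB[OF B] by blast
  \<comment> \<open>Only the value at a single \<open>F\<close> matters here, so the radius of the
    ball may depend on \<open>F\<close>.\<close>
  have "cent Y F \<in> CB" if F: "F \<in> CB" for F
  proof -
    obtain M where M: "M > 0" "\<And>z. z \<in> F \<Longrightarrow> norm z \<le> M"
      using F bounded_pos[of F] by (auto simp: CB_def)
    have "cent (scale_set (2 * M + 1) (unit_ball_of Y)) F \<in> CB"
      using cont'[of "2 * M + 1"] M(1) F by (auto simp: cont_wrt_def)
    then show ?thesis using cent_scale_set_ball_eq[OF Y F _ M(2)] M(1) by simp
  qed
  moreover
  obtain M where M: "M > 0" "\<And>z. z \<in> B \<Longrightarrow> norm z \<le> M"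
    using B bounded_pos[of B] by (auto simp: CB_def)
  \<comment> \<open>Sets at Hausdorff distance below 1 from \<open>B\<close> have all norms at most
    \<open>M + 1\<close>; this \<open>l\<close> exceeds twice that bound, so one ball serves them
    all.\<close>
  define l where "l = 2 * (M + 1) + 1"
  have l: "l > 0" using M(1) by (simp add: l_def)
  have eq: "cent (scale_set l (unit_ball_of Y)) A = cent Y A"
    if A: "A \<in> CB" and d: "hausdorff_dist A B < 1" for A
  proof (rule cent_scale_set_ball_eq[OF Y A l])
    obtain t where t: "t > 0" "t < 1" "A \<subseteq> B + scale_set t (cball 0 1)"
      using d by (auto simp: hausdorff_dist_less_iff[OF A B])
    fix z assume "z \<in> A"
    then obtain b where "b \<in> B" "norm (z - b) \<le> t"
      using t by (auto simp: subset_plus_scale_cball_iff)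
    then show "norm z \<le> M + 1"
      using M(2)[of b] norm_triangle_sub[of z b] t(2) by linarith
  qed (simp add: l_def)
  have eqB: "cent (scale_set l (unit_ball_of Y)) B = cent Y B"
    using M by (intro cent_scale_set_ball_eq[OF Y B l M(2)]) (simp_all add: l_def)
  have "\<exists>\<delta>>0. \<forall>A\<in>CB. hausdorff_dist A B < \<delta> \<longrightarrow> Q \<epsilon> (cent Y A) (cent Y B)"
    if "\<epsilon> > 0" for \<epsilon>
  proof -
    obtain \<delta> where \<delta>: "\<delta> > 0" "\<And>A. A \<in> CB \<Longrightarrow> hausdorff_dist A B < \<delta> \<Longrightarrow>
        Q \<epsilon> (cent (scale_set l (unit_ball_of Y)) A) (cent (scale_set l (unit_ball_of Y)) B)"
      using cont'[OF l] \<open>\<epsilon> > 0\<close> unfolding cont_wrt_def by blast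
    \<comment> \<open>The bound 1 keeps \<open>A\<close> in the range where both center maps
      agree.\<close>
    have "Q \<epsilon> (cent Y A) (cent Y B)" if "A \<in> CB" "hausdorff_dist A B < min \<delta> 1" for A
      using \<delta>(2)[of A] eq[of A] eqB that by simp
    then show ?thesis using \<open>\<delta> > 0\<close> by (intro exI[of _ "min \<delta> 1"]) simp
  qed
  ultimately show ?thesis by (auto simp: cont_wrt_def)
qed

theorem proposition4p6:
  fixes Y :: "'a::banach set"
  assumes "subspace Y" and "closed Y"
    and "restricted_center_property (unit_ball_of Y)"
  shows
    "(\<forall>l>0. \<forall>B\<in>CB.
        (lower_Hausdorff_semicont_at (cent (scale_set l (unit_ball_of Y))) B \<longleftrightarrow>
         lower_Hausdorff_semicont_at (cent (unit_ball_of Y)) (scale_set (1 / l) B)) \<and>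
        (upper_Hausdorff_semicont_at (cent (scale_set l (unit_ball_of Y))) B \<longleftrightarrow>
         upper_Hausdorff_semicont_at (cent (unit_ball_of Y)) (scale_set (1 / l) B))) \<and>
     ((\<forall>B\<in>CB. lower_Hausdorff_semicont_at (cent (unit_ball_of Y)) B) \<longrightarrow>
      (\<forall>B\<in>CB. lower_Hausdorff_semicont_at (cent Y) B)) \<and>
     ((\<forall>B\<in>CB. upper_Hausdorff_semicont_at (cent (unit_ball_of Y)) B) \<longrightarrow>
      (\<forall>B\<in>CB. upper_Hausdorff_semicont_at (cent Y) B)) \<and>
     (\<forall>l>0. \<forall>B\<in>CB.
        Hausdorff_metric_cont_at (cent (scale_set l (unit_ball_of Y))) B \<longleftrightarrow>
        Hausdorff_metric_cont_at (cent (unit_ball_of Y)) (scale_set (1 / l) B)) \<and>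
     ((\<forall>B\<in>CB. Hausdorff_metric_cont_at (cent (unit_ball_of Y)) B) \<longrightarrow>
      (\<forall>B\<in>CB. Hausdorff_metric_cont_at (cent Y) B))"
  unfolding lower_Hausdorff_semicont_at_eq upper_Hausdorff_semicont_at_eq
    Hausdorff_metric_cont_at_eq
  \<comment> \<open>Each conjunct is an instance of one of the two transfer lemmas; there remain the
    homogeneity of the three relations and immediate side conditions.\<close>
  by (intro conjI allI ballI impI;
      (rule cont_wrt_cent_scale_iff | rule cont_wrt_cent_subspace[OF _ assms(1)]);
      (rule homogeneous_lower homogeneous_upper homogeneous_hausdorff_dist
        | assumption | erule (1) bspec))

end
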